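(* Let $(R,S)$ be a relative Rota-Baxter system on a Leibniz algebra $(g,[\cdot,\cdot]_g)$ (over a field $\mathbb K$ of characteristic zero) with respect to a representation $(V,\rho^L,\rho^R)$, and let $(R_t=\sum_{i=0}^n\mathfrak R_it^i,\ S_t=\sum_{i=0}^n\mathfrak S_it^i)$ be an order $n$ deformation of $(R,S)$. Then $(R_t,S_t)$ is extensible if and only if its obstruction class $[Ob_{(R_t,S_t)}]\in H^2(V,g)$ is trivial, where $$Ob_{(R_t,S_t)}=-\frac12\sum_{i+j=n+1,\ i,j\ge1}[[(\mathfrak R_i,\mathfrak S_i),(\mathfrak R_j,\mathfrak S_j)]]\in C^2(V,g).$$
   Context: A Leibniz algebra is a vector space $g$ with a bilinear bracket satisfying $[x,[y,z]_g]_g=[[x,y]_g,z]_g+[y,[x,z]_g]_g$. A representation is a triple $(V,\rho^L,\rho^R)$ with $\rho^L,\rho^R:g\to gl(V)$ linear such that $\rho^L([x,y]_g)=[\rho^L(x),\rho^L(y)]$, $\rho^R([x,y]_g)=[\rho^L(x),\rho^R(y)]$, $\rho^R(y)\circ\rho^L(x)=-\rho^R(y)\circ\rho^R(x)$. A relative Rota-Baxter system with respect to $(V,\rho^L,\rho^R)$ is a pair $(R,S)$ of linear maps $V\to g$ with $[Ru,Rv]_g=R(\rho^L(Ru)v+\rho^R(Sv)u)$ and $[Su,Sv]_g=S(\rho^L(Ru)v+\rho^R(Sv)u)$ for all $u,v\in V$. An order $n$ deformation of $(R,S)$ is a pair of finite sums $R_t=\sum_{i=0}^n\mathfrak R_it^i$,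 $S_t=\sum_{i=0}^n\mathfrak S_it^i$, with $\mathfrak R_i,\mathfrak S_i:V\to g$ linear, $\mathfrak R_0=R$, $\mathfrak S_0=S$, which as $\mathbb K[[t]]/(t^{n+1})$-module maps from $V[[t]]/(t^{n+1})$ to $g[[t]]/(t^{n+1})$ satisfy $[R_tu,R_tv]_g=R_t(\rho^L(R_tu)v+\rho^R(S_tv)u)$ and $[S_tu,S_tv]_g=S_t(\rho^L(R_tu)v+\rho^R(S_tv)u)$ for $u,v\in V$ (bracket and actions extended linearly in $t$). It is extensible if there are linear maps $\mathfrak R_{n+1},\mathfrak S_{n+1}:V\to g$ such that $(R_t+t^{n+1}\mathfrak R_{n+1},S_t+t^{n+1}\mathfrak S_{n+1})$ is a deformation of order $n+1$. Bracket and cohomology: $C^n(V,g)=\mathrm{Hom}(V^{\otimes n},g\oplus g)$ for $n\ge1$, whose elements are pairs $(P,Q)$ of maps $V^{\otimes n}\to g$, viewed as multilinear maps on $M=g\oplus g\oplus V$ by $(x_i+y_i+v_i)_{i=1}^n\mapsto P(v_1,\dots,v_n)+Q(v_1,\dots,v_n)+0$. For $f\in\mathrm{Hom}(M^{\otimes p+1},M)$, $h\in\mathrm{Hom}(M^{\otimes q+1},M)$ the Balavoine bracket is $[f,h]_B=f\overline\circ h-(-1)^{pq}h\overline\circ f$ with $f\overline\circ h=\sum_{k=1}^{p+1}(-1)^{(k-1)q}f\circ_kh$, $(f\circ_kh)(x_1,\dots,x_{p+q+1})=\sum_{\sigma\in\mathbb S_{(k-1,q)}}(-1)^\sigma f(x_{\sigma(1)},\dots,x_{\sigma(k-1)},h(x_{\sigma(k)},\dots,x_{\sigma(k+q-1)},x_{k+q}),x_{k+q+1},\dots,x_{p+q+1})$,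 where $\mathbb S_{(k-1,q)}$ is the set of permutations of $\{1,\dots,k+q-1\}$ increasing on the first $k-1$ and on the last $q$ positions. Let $\widehat\mu(x_1+x_2+u,y_1+y_2+v)=[x_1,y_1]_g+[x_2,y_2]_g+\rho^L(x_1)v+\rho^R(y_2)u$ on $g\oplus g\oplus V$. For $(P,Q)\in C^m(V,g)$, $(P',Q')\in C^n(V,g)$, $[[(P,Q),(P',Q')]]=(-1)^m[[\widehat\mu,(P,Q)]_B,(P',Q')]_B\in C^{m+n}(V,g)$. Put $d_{(R,S)}=[[(R,S),\cdot]]:C^n(V,g)\to C^{n+1}(V,g)$. The cohomology $H^\bullet(V,g)$ of the relative Rota-Baxter system $(R,S)$ is that of $(C^\bullet(V,g),d_{(R,S)})$. The class $[Ob_{(R_t,S_t)}]$ of the 2-cocycle $Ob_{(R_t,S_t)}$ is called the obstruction class; it is trivial when $Ob_{(R_t,S_t)}=d_{(R,S)}(P,Q)$ for some $(P,Q)\in C^1(V,g)$.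
   Formalization: With the given formulas Ob need not be a 2-cocycle, so the class [Ob] in H^2(V,g) is taken as the coset of Ob in C^2(V,g) modulo d(C^1(V,g)); membership in H^2 is not claimed, and trivial means Ob = d(P,Q) for some (P,Q) in C^1. *)

theory Defs
  imports Complex_Main "HOL-Combinatorics.Permutations" "HOL-Library.Product_Plus"
begin

section \<open>Leibniz algebras, representations, relative Rota-Baxter systems\<close>

definition bilinear_map ::
  "('k::field \<Rightarrow> 'a::ab_group_add \<Rightarrow> 'a) \<Rightarrow> ('k \<Rightarrow> 'b::ab_group_add \<Rightarrow> 'b) \<Rightarrow>
   ('k \<Rightarrow> 'c::ab_group_add \<Rightarrow> 'c) \<Rightarrow> ('a \<Rightarrow> 'b \<Rightarrow> 'c) \<Rightarrow> bool" where
  "bilinear_map sa sb sc f \<longleftrightarrow>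
     (\<forall>x. Vector_Spaces.linear sb sc (f x)) \<and> (\<forall>y. Vector_Spaces.linear sa sc (\<lambda>x. f x y))"

locale leibniz_algebra =
  vector_space sg for sg :: "'k::field \<Rightarrow> 'g::ab_group_add \<Rightarrow> 'g" +
  fixes br :: "'g \<Rightarrow> 'g \<Rightarrow> 'g"
  assumes bracket_bilinear: "bilinear_map sg sg sg br"
    and leibniz: "br x (br y z) = br (br x y) z + br y (br x z)"

text \<open>A linear map from the algebra to \<open>gl(V)\<close> is written in curried form, as a bilinear map.\<close>

locale leibniz_representation =
  leibniz_algebra sg br + V: vector_space sv
  for sg :: "'k::field \<Rightarrow> 'g::ab_group_add \<Rightarrow> 'g" and br
    and sv :: "'k \<Rightarrow> 'v::ab_group_add \<Rightarrow> 'v" +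
  fixes rL rR :: "'g \<Rightarrow> 'v \<Rightarrow> 'v"
  assumes left_bilinear: "bilinear_map sg sv sv rL"
    and right_bilinear: "bilinear_map sg sv sv rR"
    and left_bracket: "rL (br x y) v = rL x (rL y v) - rL y (rL x v)"
    and right_bracket: "rR (br x y) v = rL x (rR y v) - rR y (rL x v)"
    and right_left: "rR y (rL x v) = - rR y (rR x v)"

locale relative_rota_baxter_system =
  leibniz_representation sg br sv rL rR
  for sg :: "'k::field \<Rightarrow> 'g::ab_group_add \<Rightarrow> 'g" and br
    and sv :: "'k \<Rightarrow> 'v::ab_group_add \<Rightarrow> 'v" and rL rR +
  fixes R S :: "'v \<Rightarrow> 'g"
  assumes R_linear: "Vector_Spaces.linear sv sg R"
    and S_linear: "Vector_Spaces.linear sv sg S"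
    and R_bracket: "br (R u) (R v) = R (rL (R u) v + rR (S v) u)"
    and S_bracket: "br (S u) (S v) = S (rL (R u) v + rR (S v) u)"

section \<open>Formal deformations\<close>

text \<open>
  A formal series \<open>\<Sum>i. a i t^i\<close> with coefficients in a vector space is its coefficient sequence.
  \<open>conv f\<close> is the extension of a bilinear map \<open>f\<close> to formal series, linear in \<open>t\<close> in both arguments,
  and working modulo \<open>t^(n+1)\<close> means comparing the coefficients of index at most \<open>n\<close>.
\<close>

definition conv ::
  "('a \<Rightarrow> 'b \<Rightarrow> 'c::comm_monoid_add) \<Rightarrow> (nat \<Rightarrow> 'a) \<Rightarrow> (nat \<Rightarrow> 'b) \<Rightarrow> nat \<Rightarrow> 'c" where
  "conv f a b = (\<lambda>k. \<Sum>i\<le>k. f (a i) (b (k - i)))"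

definition const_series :: "'a::zero \<Rightarrow> nat \<Rightarrow> 'a" where
  "const_series a = (\<lambda>k. if k = 0 then a else 0)"

definition apply_series ::
  "(nat \<Rightarrow> 'a \<Rightarrow> 'b::comm_monoid_add) \<Rightarrow> (nat \<Rightarrow> 'a) \<Rightarrow> nat \<Rightarrow> 'b" where
  "apply_series F = conv (\<lambda>f. f) F"

definition eq_upto :: "nat \<Rightarrow> (nat \<Rightarrow> 'a) \<Rightarrow> (nat \<Rightarrow> 'a) \<Rightarrow> bool" where
  "eq_upto n a b \<longleftrightarrow> (\<forall>k\<le>n. a k = b k)"

text \<open>
  The finite sums \<open>R_t\<close>, \<open>S_t\<close> of order \<open>n\<close> are coefficient sequences \<open>Rs\<close>, \<open>Ss\<close> of linear maps
  that vanish beyond \<open>n\<close>.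
\<close>

context relative_rota_baxter_system
begin

definition order_deformation :: "nat \<Rightarrow> (nat \<Rightarrow> 'v \<Rightarrow> 'g) \<Rightarrow> (nat \<Rightarrow> 'v \<Rightarrow> 'g) \<Rightarrow> bool" where
  "order_deformation n Rs Ss \<longleftrightarrow>
     (\<forall>i\<le>n. Vector_Spaces.linear sv sg (Rs i) \<and> Vector_Spaces.linear sv sg (Ss i)) \<and>
     (\<forall>i>n. Rs i = (\<lambda>_. 0) \<and> Ss i = (\<lambda>_. 0)) \<and>
     Rs 0 = R \<and> Ss 0 = S \<and>
     (\<forall>u v.
        let u' = const_series u; v' = const_series v;
            w = (\<lambda>k. conv rL (apply_series Rs u') v' k + conv rR (apply_series Ss v') u' k)
        in eq_upto n (conv br (apply_series Rs u') (apply_series Rs v')) (apply_series Rs w) \<and>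
           eq_upto n (conv br (apply_series Ss u') (apply_series Ss v')) (apply_series Ss w))"

definition extensible :: "nat \<Rightarrow> (nat \<Rightarrow> 'v \<Rightarrow> 'g) \<Rightarrow> (nat \<Rightarrow> 'v \<Rightarrow> 'g) \<Rightarrow> bool" where
  "extensible n Rs Ss \<longleftrightarrow>
     (\<exists>R' S'. Vector_Spaces.linear sv sg R' \<and> Vector_Spaces.linear sv sg S' \<and>
        order_deformation (n + 1) (Rs(n + 1 := R')) (Ss(n + 1 := S')))"

end

section \<open>The Balavoine bracket\<close>

text \<open>
  An element of \<open>Hom(M^{\<otimes>n}, N)\<close> is a function on lists which is multilinear on lists of length \<open>n\<close>;
  it is taken to be \<open>0\<close> on lists of any other length, so that equality of multilinear maps is
  equality of functions.
\<close>

definition multilinear ::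
  "('k::field \<Rightarrow> 'a::ab_group_add \<Rightarrow> 'a) \<Rightarrow> ('k \<Rightarrow> 'b::ab_group_add \<Rightarrow> 'b) \<Rightarrow>
   nat \<Rightarrow> ('a list \<Rightarrow> 'b) \<Rightarrow> bool" where
  "multilinear sa sb n f \<longleftrightarrow>
     (\<forall>xs. length xs \<noteq> n \<longrightarrow> f xs = 0) \<and>
     (\<forall>xs i. length xs = n \<longrightarrow> i < n \<longrightarrow> Vector_Spaces.linear sa sb (\<lambda>x. f (xs[i := x])))"

definition shuffle_perms :: "nat \<Rightarrow> nat \<Rightarrow> (nat \<Rightarrow> nat) set" where
  "shuffle_perms a b =
     {\<sigma>. \<sigma> permutes {1..a + b} \<and> strict_mono_on {1..a} \<sigma> \<and> strict_mono_on {a + 1..a + b} \<sigma>}"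

text \<open>
  The numbers \<open>p\<close>, \<open>q\<close> below are the degrees of \<open>f\<close>, \<open>h\<close>, whose arities are \<open>p + 1\<close> and \<open>q + 1\<close>.
  Positions are counted from \<open>1\<close>, whence the index shift in \<open>x\<close>.
\<close>

definition circ_at ::
  "('k::field \<Rightarrow> 'm::ab_group_add \<Rightarrow> 'm) \<Rightarrow> nat \<Rightarrow> nat \<Rightarrow> nat \<Rightarrow>
   ('m list \<Rightarrow> 'm) \<Rightarrow> ('m list \<Rightarrow> 'm) \<Rightarrow> 'm list \<Rightarrow> 'm" where
  "circ_at s p q k f h xs =
     (if length xs = p + q + 1 then
        let x = (\<lambda>i. xs ! (i - 1)) in
        \<Sum>\<sigma>\<in>shuffle_perms (k - 1) q. s (of_int (sign \<sigma>))
          (f (map (\<lambda>i. x (\<sigma> i)) [1..<k]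
              @ [h (map (\<lambda>i. x (\<sigma> i)) [k..<k + q] @ [x (k + q)])]
              @ map x [k + q + 1..<p + q + 2]))
      else 0)"

definition circ_bar ::
  "('k::field \<Rightarrow> 'm::ab_group_add \<Rightarrow> 'm) \<Rightarrow> nat \<Rightarrow> nat \<Rightarrow>
   ('m list \<Rightarrow> 'm) \<Rightarrow> ('m list \<Rightarrow> 'm) \<Rightarrow> 'm list \<Rightarrow> 'm" where
  "circ_bar s p q f h xs = (\<Sum>k = 1..p + 1. s ((- 1) ^ ((k - 1) * q)) (circ_at s p q k f h xs))"

definition balavoine_bracket ::
  "('k::field \<Rightarrow> 'm::ab_group_add \<Rightarrow> 'm) \<Rightarrow> nat \<Rightarrow> nat \<Rightarrow>
   ('m list \<Rightarrow> 'm) \<Rightarrow> ('m list \<Rightarrow> 'm) \<Rightarrow> 'm list \<Rightarrow> 'm" where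
  "balavoine_bracket s p q f h xs =
     circ_bar s p q f h xs - s ((- 1) ^ (p * q)) (circ_bar s q p h f xs)"

section \<open>The cochain complex and the obstruction class\<close>

text \<open>The direct sum \<open>M = g \<oplus> g \<oplus> V\<close> is the product type \<open>'g \<times> 'g \<times> 'v\<close>.\<close>

definition scale_sum ::
  "('k \<Rightarrow> 'g \<Rightarrow> 'g) \<Rightarrow> ('k \<Rightarrow> 'v \<Rightarrow> 'v) \<Rightarrow> 'k \<Rightarrow> 'g \<times> 'g \<times> 'v \<Rightarrow> 'g \<times> 'g \<times> 'v" where
  "scale_sum sg sv c = (\<lambda>(x, y, v). (sg c x, sg c y, sv c v))"

text \<open>A pair \<open>(P, Q)\<close> of maps on \<open>V^{\<otimes>n}\<close>, viewed as a map on \<open>M^{\<otimes>n}\<close>.\<close>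

definition lift_pair ::
  "('v list \<Rightarrow> 'g) \<Rightarrow> ('v list \<Rightarrow> 'g) \<Rightarrow> ('g \<times> 'g \<times> 'v) list \<Rightarrow> 'g \<times> 'g \<times> 'v::zero" where
  "lift_pair P Q ms = (let vs = map (snd \<circ> snd) ms in (P vs, Q vs, 0))"

text \<open>A map \<open>V \<rightarrow> g\<close> as an element of \<open>Hom(V^{\<otimes>1}, g)\<close>.\<close>

definition unary :: "('v \<Rightarrow> 'g::zero) \<Rightarrow> 'v list \<Rightarrow> 'g" where
  "unary R vs = (case vs of [v] \<Rightarrow> R v | _ \<Rightarrow> 0)"

context leibniz_representation
begin

abbreviation sM :: "'k \<Rightarrow> 'g \<times> 'g \<times> 'v \<Rightarrow> 'g \<times> 'g \<times> 'v" where
  "sM \<equiv> scale_sum sg sv"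

definition mu_hat :: "('g \<times> 'g \<times> 'v) list \<Rightarrow> 'g \<times> 'g \<times> 'v" where
  "mu_hat ms =
     (case ms of
        [(x1, x2, u), (y1, y2, v)] \<Rightarrow> (br x1 y1, br x2 y2, rL x1 v + rR y2 u)
      | _ \<Rightarrow> 0)"

definition cochains :: "nat \<Rightarrow> (('g \<times> 'g \<times> 'v) list \<Rightarrow> 'g \<times> 'g \<times> 'v) set" where
  "cochains n = {lift_pair P Q | P Q. multilinear sv sg n P \<and> multilinear sv sg n Q}"

text \<open>The bracket of \<open>a \<in> C\<^sup>m\<close> and \<open>b \<in> C\<^sup>n\<close>, where \<open>m, n \<ge> 1\<close>; their degrees are \<open>m - 1\<close>, \<open>n - 1\<close>.\<close>

definition cochain_bracket ::
  "nat \<Rightarrow> nat \<Rightarrow> (('g \<times> 'g \<times> 'v) list \<Rightarrow> 'g \<times> 'g \<times> 'v) \<Rightarrow>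
   (('g \<times> 'g \<times> 'v) list \<Rightarrow> 'g \<times> 'g \<times> 'v) \<Rightarrow> ('g \<times> 'g \<times> 'v) list \<Rightarrow> 'g \<times> 'g \<times> 'v" where
  "cochain_bracket m n a b xs =
     sM ((- 1) ^ m)
       (balavoine_bracket sM m (n - 1) (balavoine_bracket sM 1 (m - 1) mu_hat a) b xs)"

definition obstruction ::
  "nat \<Rightarrow> (nat \<Rightarrow> 'v \<Rightarrow> 'g) \<Rightarrow> (nat \<Rightarrow> 'v \<Rightarrow> 'g) \<Rightarrow>
   ('g \<times> 'g \<times> 'v) list \<Rightarrow> 'g \<times> 'g \<times> 'v" where
  "obstruction n Rs Ss xs =
     sM (- (1 / 2))
       (\<Sum>(i, j) \<in> {(i, j). i + j = n + 1 \<and> i \<ge> 1 \<and> j \<ge> 1}.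
          cochain_bracket 1 1 (lift_pair (unary (Rs i)) (unary (Ss i)))
                              (lift_pair (unary (Rs j)) (unary (Ss j))) xs)"

end

context relative_rota_baxter_system
begin

definition differential ::
  "nat \<Rightarrow> (('g \<times> 'g \<times> 'v) list \<Rightarrow> 'g \<times> 'g \<times> 'v) \<Rightarrow>
   ('g \<times> 'g \<times> 'v) list \<Rightarrow> 'g \<times> 'g \<times> 'v" where
  "differential n c = cochain_bracket 1 n (lift_pair (unary R) (unary S)) c"

definition cocycles :: "nat \<Rightarrow> (('g \<times> 'g \<times> 'v) list \<Rightarrow> 'g \<times> 'g \<times> 'v) set" where
  "cocycles n = {c \<in> cochains n. differential n c = (\<lambda>_. 0)}"

text \<open>The complex starts in degree \<open>1\<close>.\<close>

definition coboundaries :: "nat \<Rightarrow> (('g \<times> 'g \<times> 'v) list \<Rightarrow> 'g \<times> 'g \<times> 'v) set" where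
  "coboundaries n =
     (if n \<le> 1 then {\<lambda>_. 0} else differential (n - 1) ` cochains (n - 1))"

text \<open>
  The class of a cochain is its coset modulo coboundaries, and the zero class is the class of \<open>0\<close>.
  The coset makes sense for any cochain: with these formulas \<open>differential (n + 1) \<circ> differential n\<close>
  is not zero in general, since \<open>mu_hat\<close> need not satisfy the
  Leibniz identity (\<open>rL\<close> acts through the first copy of \<open>g\<close> and \<open>rR\<close> through the second).
\<close>

definition cohomology_class :: "nat \<Rightarrow> (('g \<times> 'g \<times> 'v) list \<Rightarrow> 'g \<times> 'g \<times> 'v) \<Rightarrow> (('g \<times> 'g \<times> 'v) list \<Rightarrow> 'g \<times> 'g \<times> 'v) set" where
  "cohomology_class n c = {b \<in> cochains n. (\<lambda>xs. b xs - c xs) \<in> coboundaries n}"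

definition cohomology :: "nat \<Rightarrow> (('g \<times> 'g \<times> 'v) list \<Rightarrow> 'g \<times> 'g \<times> 'v) set set" where
  "cohomology n = cohomology_class n ` cocycles n"

definition trivial_class :: "nat \<Rightarrow> (('g \<times> 'g \<times> 'v) list \<Rightarrow> 'g \<times> 'g \<times> 'v) set \<Rightarrow> bool" where
  "trivial_class n X \<longleftrightarrow> X = cohomology_class n (\<lambda>_. 0)"

definition obstruction_class ::
  "nat \<Rightarrow> (nat \<Rightarrow> 'v \<Rightarrow> 'g) \<Rightarrow> (nat \<Rightarrow> 'v \<Rightarrow> 'g) \<Rightarrow>
   (('g \<times> 'g \<times> 'v) list \<Rightarrow> 'g \<times> 'g \<times> 'v) set" where
  "obstruction_class n Rs Ss = cohomology_class 2 (obstruction n Rs Ss)"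

end

subsection \<open>A class in degree two is trivial iff its representative is a coboundary\<close>

lemma shuffle_perms_small:
  "shuffle_perms 0 0 = {id}" "shuffle_perms (Suc 0) 0 = {id}" "shuffle_perms 0 (Suc 0) = {id}"
  by (auto simp: shuffle_perms_def strict_mono_on_def)

lemma multilinear_1D:
  assumes "multilinear sa sb 1 P"
  shows "P [u + v] = P [u] + P [v]" "P [sa c u] = sb c (P [u])" "length xs \<noteq> 1 \<Longrightarrow> P xs = 0"
proof -
  have "Vector_Spaces.linear sa sb (\<lambda>x. P ([0][0 := x]))"
    using assms unfolding multilinear_def by (metis length_Cons list.size(3) less_one One_nat_def)
  then have l: "Vector_Spaces.linear sa sb (\<lambda>x. P [x])" by simp
  show "P [u + v] = P [u] + P [v]" "P [sa c u] = sb c (P [u])"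
    using module_hom.add[OF l[folded module_hom_iff_linear]]
      module_hom.scale[OF l[folded module_hom_iff_linear]] by auto
  show "length xs \<noteq> 1 \<Longrightarrow> P xs = 0"
    using assms unfolding multilinear_def by blast
qed

lemma multilinear_1I:
  assumes "vector_space sa" "vector_space sb"
    and "\<And>xs. length xs \<noteq> 1 \<Longrightarrow> P xs = 0"
    and "\<And>u v. P [u + v] = P [u] + P [v]" "\<And>c u. P [sa c u] = sb c (P [u])"
  shows "multilinear sa sb 1 P"
proof -
  have "Vector_Spaces.linear sa sb (\<lambda>x. P (xs[i := x]))" if "length xs = 1" "i < 1" for xs i
  proof -
    from that obtain a where "xs = [a]" "i = 0" by (auto simp: length_Suc_conv)
    then show ?thesis using assms unfolding Vector_Spaces.linear_iff by simp
  qed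
  with assms(3) show ?thesis unfolding multilinear_def by auto
qed

context relative_rota_baxter_system
begin

lemma sM_one: "sM 1 x = x"
  by (cases x) (simp add: scale_sum_def)

lemma sM_m1: "sM (- 1) x = - x"
  by (cases x) (simp add: scale_sum_def)

lemma balavoine_1_0:
  "balavoine_bracket sM 1 0 f h xs =
     (if length xs = 2
      then f [h [xs ! 0], xs ! 1] + f [xs ! 0, h [xs ! 1]] - h [f [xs ! 0, xs ! 1]] else 0)"
proof (cases "length xs = 2")
  case True
  have i: "{1..2::nat} = {1, 2}" by auto
  show ?thesis using True
    by (simp add: balavoine_bracket_def circ_bar_def circ_at_def i shuffle_perms_small sM_one
        numeral_2_eq_2 Let_def upt_rec sign_id)
next
  case False
  then show ?thesis
    by (auto simp: balavoine_bracket_def circ_bar_def circ_at_def scale_sum_def)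
qed

lemma differential_1:
  "differential 1 c xs =
     (if length xs = 2 then
        let A = lift_pair (unary R) (unary S);
            F = (\<lambda>x y. mu_hat [A [x], y] + mu_hat [x, A [y]] - A [mu_hat [x, y]])
        in - (F (c [xs ! 0]) (xs ! 1) + F (xs ! 0) (c [xs ! 1]) - c [F (xs ! 0) (xs ! 1)])
      else 0)"
proof -
  have F: "balavoine_bracket sM 1 (1 - 1) f h = balavoine_bracket sM 1 0 f h" for f h
    by simp
  show ?thesis
    unfolding differential_def cochain_bracket_def F
    by (simp add: balavoine_1_0[simplified] sM_m1 Let_def)
qed

lemma bilin:
  "br (x + y) z = br x z + br y z" "br x (y + z) = br x y + br x z"
  "rL (x + y) v = rL x v + rL y v" "rL x (v + w) = rL x v + rL x w"
  "rR (x + y) v = rR x v + rR y v" "rR x (v + w) = rR x v + rR x w"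
  "R (v + w) = R v + R w" "S (v + w) = S v + S w"
  using bracket_bilinear left_bilinear right_bilinear R_linear S_linear
  by (auto simp: bilinear_map_def Vector_Spaces.linear_iff)

lemma bilin_zero:
  "br 0 z = 0" "br x 0 = 0" "rL 0 v = 0" "rL x 0 = 0" "rR 0 v = 0" "rR x 0 = 0"
  "R 0 = 0" "S 0 = 0"
  using bilin(1)[of 0 0] bilin(2)[of _ 0 0] bilin(3)[of 0 0] bilin(4)[of _ 0 0]
    bilin(5)[of 0 0] bilin(6)[of _ 0 0] bilin(7)[of 0 0] bilin(8)[of 0 0] by auto

lemma cochains_1_lin:
  assumes "a \<in> cochains 1" "b \<in> cochains 1"
  shows "(\<lambda>xs. a xs + b xs) \<in> cochains 1" "(\<lambda>xs. - a xs) \<in> cochains 1"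
proof -
  obtain P Q where a: "a = lift_pair P Q" and P: "multilinear sv sg 1 P" and Q: "multilinear sv sg 1 Q"
    using assms(1) by (auto simp: cochains_def)
  obtain P' Q' where b: "b = lift_pair P' Q'" and P': "multilinear sv sg 1 P'" and Q': "multilinear sv sg 1 Q'"
    using assms(2) by (auto simp: cochains_def)
  note l = multilinear_1D[OF P] multilinear_1D[OF Q] multilinear_1D[OF P'] multilinear_1D[OF Q']
  have vs: "vector_space sv" "vector_space sg" by unfold_locales
  have "multilinear sv sg 1 (\<lambda>xs. P xs + P' xs)" "multilinear sv sg 1 (\<lambda>xs. Q xs + Q' xs)"
    "multilinear sv sg 1 (\<lambda>xs. - P xs)" "multilinear sv sg 1 (\<lambda>xs. - Q xs)"
    by (rule multilinear_1I[OF vs]; simp add: l scale_right_distrib algebra_simps)+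
  moreover have "(\<lambda>xs. a xs + b xs) = lift_pair (\<lambda>xs. P xs + P' xs) (\<lambda>xs. Q xs + Q' xs)"
    "(\<lambda>xs. - a xs) = lift_pair (\<lambda>xs. - P xs) (\<lambda>xs. - Q xs)"
    by (auto simp: a b lift_pair_def Let_def)
  ultimately show "(\<lambda>xs. a xs + b xs) \<in> cochains 1" "(\<lambda>xs. - a xs) \<in> cochains 1"
    unfolding cochains_def by blast+
qed

lemma differential_1_add:
  assumes "a \<in> cochains 1" "b \<in> cochains 1"
  shows "differential 1 (\<lambda>xs. a xs + b xs) xs = differential 1 a xs + differential 1 b xs"
proof -
  obtain P Q where a: "a = lift_pair P Q" and P: "multilinear sv sg 1 P" and Q: "multilinear sv sg 1 Q"
    using assms(1) by (auto simp: cochains_def)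
  obtain P' Q' where b: "b = lift_pair P' Q'" and P': "multilinear sv sg 1 P'" and Q': "multilinear sv sg 1 Q'"
    using assms(2) by (auto simp: cochains_def)
  note l = multilinear_1D(1)[OF P] multilinear_1D(1)[OF Q] multilinear_1D(1)[OF P'] multilinear_1D(1)[OF Q']
  show ?thesis
    unfolding differential_1
    by (cases "xs ! 0"; cases "xs ! 1")
      (simp add: a b lift_pair_def mu_hat_def unary_def Let_def bilin bilin_zero l algebra_simps)
qed

lemma coboundaries_2_lin:
  shows "(\<lambda>_. 0) \<in> coboundaries 2"
    and "a \<in> coboundaries 2 \<Longrightarrow> b \<in> coboundaries 2 \<Longrightarrow> (\<lambda>xs. a xs + b xs) \<in> coboundaries 2"
    and "a \<in> coboundaries 2 \<Longrightarrow> (\<lambda>xs. - a xs) \<in> coboundaries 2"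
proof -
  have B: "coboundaries 2 = differential 1 ` cochains 1"
    by (simp add: coboundaries_def)
  have vs: "vector_space sv" "vector_space sg" by unfold_locales
  have "multilinear sv sg 1 (\<lambda>_. 0)"
    by (rule multilinear_1I[OF vs]) auto
  then have z: "(\<lambda>_. 0) \<in> cochains 1"
    unfolding cochains_def by (force simp: lift_pair_def zero_prod_def)
  have dz: "differential 1 (\<lambda>_. 0) = (\<lambda>_. 0)"
    using differential_1_add[OF z z] by auto
  show "(\<lambda>_. 0) \<in> coboundaries 2"
    unfolding B using z dz by force
  show "(\<lambda>xs. a xs + b xs) \<in> coboundaries 2" if ab: "a \<in> coboundaries 2" "b \<in> coboundaries 2"
  proof -
    from ab obtain c e where c: "c \<in> cochains 1" "a = differential 1 c"
      and e: "e \<in> cochains 1" "b = differential 1 e"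
      unfolding B by blast
    then have "(\<lambda>xs. a xs + b xs) = differential 1 (\<lambda>xs. c xs + e xs)"
      using differential_1_add[OF c(1) e(1)] by auto
    then show ?thesis
      unfolding B using cochains_1_lin(1)[OF c(1) e(1)] by blast
  qed
  show "(\<lambda>xs. - a xs) \<in> coboundaries 2" if "a \<in> coboundaries 2"
  proof -
    from that obtain c where c: "c \<in> cochains 1" "a = differential 1 c"
      unfolding B by blast
    note m = cochains_1_lin(2)[OF c(1) c(1)]
    have "a xs + differential 1 (\<lambda>xs. - c xs) xs = 0" for xs
      using differential_1_add[OF c(1) m, of xs] dz by (simp add: c(2))
    then have "(\<lambda>xs. - a xs) = differential 1 (\<lambda>xs. - c xs)"
      by (auto simp: eq_neg_iff_add_eq_0 minus_equation_iff neg_eq_iff_add_eq_0)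
    then show ?thesis unfolding B using m by blast
  qed
qed

lemma trivial_class_iff_coboundary:
  assumes "c \<in> cochains 2"
  shows "trivial_class 2 (cohomology_class 2 c) \<longleftrightarrow> (\<exists>b\<in>cochains 1. c = differential 1 b)"
proof -
  have "trivial_class 2 (cohomology_class 2 c) \<longleftrightarrow> c \<in> coboundaries 2"
  proof
    assume "trivial_class 2 (cohomology_class 2 c)"
    moreover have "c \<in> cohomology_class 2 c"
      using assms coboundaries_2_lin(1) by (simp add: cohomology_class_def)
    ultimately show "c \<in> coboundaries 2"
      by (simp add: trivial_class_def cohomology_class_def)
  next
    assume c: "c \<in> coboundaries 2"
    have "(\<lambda>xs. b xs - c xs) \<in> coboundaries 2 \<longleftrightarrow> b \<in> coboundaries 2" for b
      using coboundaries_2_lin(2)[of "\<lambda>xs. b xs - c xs" c]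
        coboundaries_2_lin(2)[of b "\<lambda>xs. - c xs"] coboundaries_2_lin(3)[OF c] c by auto
    then show "trivial_class 2 (cohomology_class 2 c)"
      by (simp add: trivial_class_def cohomology_class_def)
  qed
  then show ?thesis by (auto simp: coboundaries_def)
qed

end

end

theory Submission
  imports Defs
begin

text \<open>
  On cochains that come from linear maps \<open>V \<rightarrow> g\<close>, the graded bracket is the polarisation of the
  two quadratic identities that define a relative Rota-Baxter system. In detail, put
  \<open>D K (K', P', Q') u v = [K u, K' v] - K (rL (P' u) v + rR (Q' v) u)\<close>. The Rota-Baxter
  identities for \<open>(P, Q)\<close> are \<open>D P (P, P, Q) = 0\<close> and \<open>D Q (Q, P, Q) = 0\<close>, and the components of
  \<open>- [[(P\<^sub>1, Q\<^sub>1), (P\<^sub>2, Q\<^sub>2)]]\<close> are the two expressions \<open>D\<close> symmetrised in the indices 1 and 2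
  (lemma \<open>cochain_bracket_unary\<close>).

  The coefficient of \<open>t^k\<close> in the deformation equations is the sum over \<open>i + j = k\<close> of \<open>D\<close> with
  outer map of index \<open>i\<close> and inner maps of index \<open>j\<close> (lemma \<open>order_deformation_iff\<close>). Adding terms
  of order \<open>n + 1\<close> leaves the coefficients up to \<open>t^n\<close> alone, so only the coefficient of \<open>t^(n + 1)\<close>
  has to be solved. There the summands with \<open>i, j \<ge> 1\<close> involve only the given maps, and their sum
  is the obstruction: the factor \<open>1/2\<close> undoes the symmetrisation. The two summands with \<open>i = 0\<close> or
  \<open>j = 0\<close> involve the new pair \<open>(R', S')\<close> and give \<open>- d(R', S')\<close>. The new equation therefore reads
  \<open>Ob = d(R', S')\<close>, and since every 1-cochain is given by such a pair, it has a solution exactly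
  when \<open>Ob\<close> is a coboundary.
\<close>

section \<open>Binary cochains\<close>

definition binary :: "('v \<Rightarrow> 'v \<Rightarrow> 'g::zero) \<Rightarrow> 'v list \<Rightarrow> 'g" where
  "binary f vs = (case vs of [u, v] \<Rightarrow> f u v | _ \<Rightarrow> 0)"

lemma binary_simps [simp]:
  "binary f [u, v] = f u v" "length vs \<noteq> 2 \<Longrightarrow> binary f vs = 0"
  by (auto simp: binary_def split: list.split)

lemma multilinear_binary:
  assumes "bilinear_map sa sa sb f"
  shows "multilinear sa sb 2 (binary f)"
proof -
  have "Vector_Spaces.linear sa sb (\<lambda>x. binary f (xs[i := x]))" if "length xs = 2" "i < 2" for xs i
  proof -
    from that obtain a b where "xs = [a, b]"
      by (auto simp: numeral_2_eq_2 length_Suc_conv)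
    moreover from that have "i = 0 \<or> i = 1" by auto
    ultimately show ?thesis using assms by (auto simp: bilinear_map_def)
  qed
  then show ?thesis by (auto simp: multilinear_def)
qed

lemma lift_pair_binary_eq_iff:
  "lift_pair (binary f) (binary f') = lift_pair (binary h) (binary h') \<longleftrightarrow>
     (\<forall>u v. f u v = h u v \<and> f' u v = h' u v)" (is "?L \<longleftrightarrow> ?R")
proof
  assume ?L
  from fun_cong[OF this, of "[(0, 0, _), (0, 0, _)]"] show ?R
    by (simp add: lift_pair_def)
next
  assume ?R
  then have "f = h" "f' = h'" by (simp_all add: fun_eq_iff)
  then show ?L by simp
qed

lemma sum_lift_pair_binary:
  fixes f h :: "'i \<Rightarrow> 'v::ab_group_add \<Rightarrow> 'v \<Rightarrow> 'g::ab_group_add"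
  shows "(\<Sum>i\<in>I. lift_pair (binary (f i)) (binary (h i)) xs) =
     lift_pair (binary (\<lambda>u v. \<Sum>i\<in>I. f i u v)) (binary (\<lambda>u v. \<Sum>i\<in>I. h i u v)) xs"
proof -
  have "(\<Sum>i\<in>I. binary (k i) vs) = binary (\<lambda>u v. \<Sum>i\<in>I. k i u v) vs"
    for k :: "'i \<Rightarrow> 'v \<Rightarrow> 'v \<Rightarrow> 'g" and vs
    by (auto simp: binary_def split: list.split)
  then show ?thesis
    by (simp add: lift_pair_def Let_def prod_eq_iff fst_sum snd_sum)
qed

lemma multilinear_1_unary:
  assumes "multilinear sa sb 1 P"
  shows "P = unary (\<lambda>v. P [v])"
  using multilinear_1D(3)[OF assms] by (auto simp: unary_def fun_eq_iff split: list.split)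

context relative_rota_baxter_system
begin

lemma vector_spaces: "vector_space sv" "vector_space sg"
  by unfold_locales

lemma cochains_1_iff:
  "c \<in> cochains 1 \<longleftrightarrow>
     (\<exists>P Q. Vector_Spaces.linear sv sg P \<and> Vector_Spaces.linear sv sg Q \<and>
        c = lift_pair (unary P) (unary Q))" (is "?L \<longleftrightarrow> ?R")
proof
  assume ?L
  then obtain P Q where c: "c = lift_pair P Q"
    and P: "multilinear sv sg 1 P" and Q: "multilinear sv sg 1 Q"
    by (auto simp: cochains_def)
  have "Vector_Spaces.linear sv sg (\<lambda>v. P [v])" "Vector_Spaces.linear sv sg (\<lambda>v. Q [v])"
    using vector_spaces by (simp_all add: Vector_Spaces.linear_iff multilinear_1D(1,2)[OF P]
      multilinear_1D(1,2)[OF Q])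
  then show ?R
    using c multilinear_1_unary[OF P] multilinear_1_unary[OF Q] by metis
next
  have "multilinear sv sg 1 (unary P)" if "Vector_Spaces.linear sv sg P" for P
    using that by (intro multilinear_1I vector_spaces)
      (auto simp: unary_def Vector_Spaces.linear_iff split: list.split)
  then show "?R \<Longrightarrow> ?L" by (auto simp: cochains_def)
qed

section \<open>The bracket as polarised Rota-Baxter identity\<close>

text \<open>
  With \<open>K = K' = P\<close> the vanishing of this expression is the first Rota-Baxter identity for
  \<open>(P, Q)\<close>, with \<open>K = K' = Q\<close> the second. The outer map is a separate argument because it carries
  the first index of a product of two series, and \<open>K', P, Q\<close> carry the second.
\<close>

definition rb_defect ::
  "('v \<Rightarrow> 'g) \<Rightarrow> ('v \<Rightarrow> 'g) \<Rightarrow> ('v \<Rightarrow> 'g) \<Rightarrow> ('v \<Rightarrow> 'g) \<Rightarrow> 'v \<Rightarrow> 'v \<Rightarrow> 'g" where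
  "rb_defect K K' P Q u v = br (K u) (K' v) - K (rL (P u) v + rR (Q v) u)"

lemma bilinear_scale:
  "br (sg c x) y = sg c (br x y)" "br x (sg c y) = sg c (br x y)"
  "rL (sg c x) v = sv c (rL x v)" "rL x (sv c v) = sv c (rL x v)"
  "rR (sg c x) v = sv c (rR x v)" "rR x (sv c v) = sv c (rR x v)"
  using bracket_bilinear left_bilinear right_bilinear
  by (auto simp: bilinear_map_def Vector_Spaces.linear_iff)

lemma linear_simps:
  assumes "Vector_Spaces.linear sv sg P"
  shows "P (u + v) = P u + P v" "P (sv c u) = sg c (P u)" "P 0 = 0"
proof -
  show add: "P (u + v) = P u + P v" for u v
    using assms by (simp add: Vector_Spaces.linear_iff)
  show "P (sv c u) = sg c (P u)"
    using assms by (simp add: Vector_Spaces.linear_iff)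
  show "P 0 = 0" using add[of 0 0] by simp
qed

lemma bilinear_rb_defect:
  assumes "Vector_Spaces.linear sv sg K" "Vector_Spaces.linear sv sg K'"
    "Vector_Spaces.linear sv sg P" "Vector_Spaces.linear sv sg Q"
  shows "bilinear_map sv sv sg (rb_defect K K' P Q)"
  using vector_spaces
  by (auto simp: bilinear_map_def Vector_Spaces.linear_iff rb_defect_def bilin(1-6) bilinear_scale
      linear_simps(1,2)[OF assms(1)] linear_simps(1,2)[OF assms(2)]
      linear_simps(1,2)[OF assms(3)] linear_simps(1,2)[OF assms(4)]
      scale_right_diff_distrib scale_right_distrib)

lemma bilinear_sum:
  assumes "\<And>i. i \<in> I \<Longrightarrow> bilinear_map sv sv sg (f i)"
  shows "bilinear_map sv sv sg (\<lambda>u v. \<Sum>i\<in>I. f i u v)"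
  using assms vector_spaces
  by (auto simp: bilinear_map_def Vector_Spaces.linear_iff sum.distrib scale_sum_right)

text \<open>
  The image of a lifted cochain has zero component in \<open>V\<close> and the cochain sees only that
  component, so every term that applies one of the two cochains to a value of the other vanishes.
  Of the nested bracket with \<open>mu_hat\<close> there remain the terms in which each cochain is applied once,
  either to an argument or to a value of \<open>mu_hat\<close>.
\<close>

lemma cochain_bracket_unary:
  assumes lin: "Vector_Spaces.linear sv sg P" "Vector_Spaces.linear sv sg Q"
    "Vector_Spaces.linear sv sg P'" "Vector_Spaces.linear sv sg Q'"
  shows "cochain_bracket 1 1 (lift_pair (unary P) (unary Q)) (lift_pair (unary P') (unary Q')) =
    lift_pair (binary (\<lambda>u v. - (rb_defect P P' P' Q' u v + rb_defect P' P P Q u v)))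
              (binary (\<lambda>u v. - (rb_defect Q Q' P' Q' u v + rb_defect Q' Q P Q u v)))"
    (is "?l = ?r")
proof
  fix xs
  have deg: "balavoine_bracket sM 1 (1 - 1) f h = balavoine_bracket sM 1 0 f h" for f h
    by simp
  show "?l xs = ?r xs"
  proof (cases "length xs = 2")
    case False
    then show ?thesis
      unfolding cochain_bracket_def deg
      by (simp add: balavoine_1_0[simplified] sM_m1 lift_pair_def zero_prod_def)
  next
    case True
    then obtain x1 x2 u y1 y2 v where "xs = [(x1, x2, u), (y1, y2, v)]"
      by (auto simp: numeral_2_eq_2 length_Suc_conv)
    then show ?thesis
      unfolding cochain_bracket_def deg
      by (simp add: balavoine_1_0[simplified] sM_m1 lift_pair_def mu_hat_def unary_def Let_def
          rb_defect_def bilin(1-6) bilin_zero(1-6) linear_simps(1,3)[OF lin(1)]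
          linear_simps(1,3)[OF lin(2)] linear_simps(1,3)[OF lin(3)] linear_simps(1,3)[OF lin(4)]
          algebra_simps)
  qed
qed

lemma differential_unary:
  assumes "Vector_Spaces.linear sv sg P" "Vector_Spaces.linear sv sg Q"
  shows "differential 1 (lift_pair (unary P) (unary Q)) =
    lift_pair (binary (\<lambda>u v. - (rb_defect R P P Q u v + rb_defect P R R S u v)))
              (binary (\<lambda>u v. - (rb_defect S Q P Q u v + rb_defect Q S R S u v)))"
  unfolding differential_def by (rule cochain_bracket_unary[OF R_linear S_linear assms])

section \<open>Coefficients of the deformation equations\<close>

definition rb_coeff ::
  "(nat \<Rightarrow> 'v \<Rightarrow> 'g) \<Rightarrow> (nat \<Rightarrow> 'v \<Rightarrow> 'g) \<Rightarrow> (nat \<Rightarrow> 'v \<Rightarrow> 'g) \<Rightarrow> nat \<Rightarrow> 'v \<Rightarrow> 'v \<Rightarrow> 'g" where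
  "rb_coeff Ks Rs Ss k u v =
     (\<Sum>i\<le>k. rb_defect (Ks i) (Ks (k - i)) (Rs (k - i)) (Ss (k - i)) u v)"

text \<open>
  The outer summands \<open>i = 0\<close> and \<open>i = n + 1\<close> are split off, which leaves the part of the
  coefficient of \<open>t^(n + 1)\<close> in which only terms of index between \<open>1\<close> and \<open>n\<close> occur.
\<close>

definition rb_inner_coeff ::
  "(nat \<Rightarrow> 'v \<Rightarrow> 'g) \<Rightarrow> (nat \<Rightarrow> 'v \<Rightarrow> 'g) \<Rightarrow> (nat \<Rightarrow> 'v \<Rightarrow> 'g) \<Rightarrow> nat \<Rightarrow> 'v \<Rightarrow> 'v \<Rightarrow> 'g" where
  "rb_inner_coeff Ks Rs Ss n u v =
     (\<Sum>i = 1..n. rb_defect (Ks i) (Ks (n + 1 - i)) (Rs (n + 1 - i)) (Ss (n + 1 - i)) u v)"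

lemma rb_coeff_Suc:
  "rb_coeff Ks Rs Ss (n + 1) u v =
     rb_inner_coeff Ks Rs Ss n u v +
     (rb_defect (Ks 0) (Ks (n + 1)) (Rs (n + 1)) (Ss (n + 1)) u v +
      rb_defect (Ks (n + 1)) (Ks 0) (Rs 0) (Ss 0) u v)"
proof -
  have "{..n + 1} = insert 0 (insert (n + 1) {1..n})" by auto
  then show ?thesis by (simp add: rb_coeff_def rb_inner_coeff_def algebra_simps)
qed

lemma conv_const_series:
  assumes "\<And>x. f x 0 = 0"
  shows "conv f a (const_series b) k = f (a k) b"
proof -
  have "conv f a (const_series b) k = (\<Sum>i\<le>k. if i = k then f (a i) b else 0)"
    unfolding conv_def by (rule sum.cong) (auto simp: const_series_def assms)
  then show ?thesis by simp
qed

lemma apply_const_series: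
  assumes "\<And>i. Vector_Spaces.linear sv sg (Ps i)"
  shows "apply_series Ps (const_series u) k = Ps k u"
proof -
  have "apply_series Ps (const_series u) k = (\<Sum>i\<le>k. if i = k then Ps i u else 0)"
    unfolding apply_series_def conv_def
    by (rule sum.cong) (auto simp: const_series_def linear_simps(3)[OF assms])
  then show ?thesis by simp
qed

text \<open>
  The deformation equations quantify over constant series \<open>u\<close>, \<open>v\<close> only, and a product with a
  constant series has a single nonzero summand in each degree.
\<close>

lemma deformation_equation_iff:
  assumes lin: "\<And>i. Vector_Spaces.linear sv sg (Ks i)" "\<And>i. Vector_Spaces.linear sv sg (Rs i)"
    "\<And>i. Vector_Spaces.linear sv sg (Ss i)"
  shows "eq_upto n
      (conv br (apply_series Ks (const_series u)) (apply_series Ks (const_series v)))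
      (apply_series Ks (\<lambda>k. conv rL (apply_series Rs (const_series u)) (const_series v) k +
                            conv rR (apply_series Ss (const_series v)) (const_series u) k)) \<longleftrightarrow>
    (\<forall>k\<le>n. rb_coeff Ks Rs Ss k u v = 0)"
proof -
  have outer: "apply_series Ks w k = (\<Sum>i\<le>k. Ks i (w (k - i)))" for w k
    by (simp add: apply_series_def conv_def)
  show ?thesis
    unfolding eq_upto_def
      conv_const_series[of rL, OF bilin_zero(4)] conv_const_series[of rR, OF bilin_zero(6)]
      apply_const_series[OF lin(2)] apply_const_series[OF lin(3)]
      conv_def[of br] apply_const_series[OF lin(1)]
    by (simp add: outer rb_coeff_def rb_defect_def sum_subtractf)
qed

lemma order_deformation_iff:
  "order_deformation n Rs Ss \<longleftrightarrow>
     (\<forall>i. Vector_Spaces.linear sv sg (Rs i) \<and> Vector_Spaces.linear sv sg (Ss i)) \<and>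
     (\<forall>i>n. Rs i = (\<lambda>_. 0) \<and> Ss i = (\<lambda>_. 0)) \<and> Rs 0 = R \<and> Ss 0 = S \<and>
     (\<forall>k\<le>n. \<forall>u v. rb_coeff Rs Rs Ss k u v = 0 \<and> rb_coeff Ss Rs Ss k u v = 0)"
    (is "_ \<longleftrightarrow> ?lin \<and> ?van \<and> _")
proof -
  have zero: "Vector_Spaces.linear sv sg (\<lambda>_. 0)"
    using vector_spaces by (simp add: Vector_Spaces.linear_iff)
  have upto: "(\<forall>i\<le>n. Vector_Spaces.linear sv sg (Rs i) \<and> Vector_Spaces.linear sv sg (Ss i)) \<longleftrightarrow> ?lin"
    if ?van
    using that zero by (metis linorder_not_less)
  have eqs: "(\<forall>u v.
        let u' = const_series u; v' = const_series v;
            w = (\<lambda>k. conv rL (apply_series Rs u') v' k + conv rR (apply_series Ss v') u' k)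
        in eq_upto n (conv br (apply_series Rs u') (apply_series Rs v')) (apply_series Rs w) \<and>
           eq_upto n (conv br (apply_series Ss u') (apply_series Ss v')) (apply_series Ss w)) \<longleftrightarrow>
     (\<forall>k\<le>n. \<forall>u v. rb_coeff Rs Rs Ss k u v = 0 \<and> rb_coeff Ss Rs Ss k u v = 0)"
    if ?lin
  proof -
    from that have lin: "\<And>i. Vector_Spaces.linear sv sg (Rs i)"
      "\<And>i. Vector_Spaces.linear sv sg (Ss i)" by auto
    show ?thesis
      unfolding Let_def deformation_equation_iff[OF lin(1) lin(1) lin(2)]
        deformation_equation_iff[OF lin(2) lin(1) lin(2)] by blast
  qed
  show ?thesis
    unfolding order_deformation_def using upto eqs by blast
qed

lemma order_deformation_extend_iff:
  assumes def: "order_deformation n Rs Ss"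
    and lin: "Vector_Spaces.linear sv sg R'" "Vector_Spaces.linear sv sg S'"
  shows "order_deformation (n + 1) (Rs(n + 1 := R')) (Ss(n + 1 := S')) \<longleftrightarrow>
    (\<forall>u v.
       rb_inner_coeff Rs Rs Ss n u v + (rb_defect R R' R' S' u v + rb_defect R' R R S u v) = 0 \<and>
       rb_inner_coeff Ss Rs Ss n u v + (rb_defect S S' R' S' u v + rb_defect S' S R S u v) = 0)"
    (is "_ \<longleftrightarrow> ?eqs")
proof -
  let ?Rs = "Rs(n + 1 := R')" and ?Ss = "Ss(n + 1 := S')"
  note d = def[unfolded order_deformation_iff]
  have low: "rb_coeff ?Rs ?Rs ?Ss k u v = 0 \<and> rb_coeff ?Ss ?Rs ?Ss k u v = 0" if "k \<le> n" for k u v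
  proof -
    have "rb_coeff ?Rs ?Rs ?Ss k u v = rb_coeff Rs Rs Ss k u v"
      "rb_coeff ?Ss ?Rs ?Ss k u v = rb_coeff Ss Rs Ss k u v"
      unfolding rb_coeff_def using that by (auto intro!: sum.cong)
    then show ?thesis using d that by simp
  qed
  have inner: "rb_inner_coeff ?Rs ?Rs ?Ss n = rb_inner_coeff Rs Rs Ss n"
    "rb_inner_coeff ?Ss ?Rs ?Ss n = rb_inner_coeff Ss Rs Ss n"
    by (auto simp: rb_inner_coeff_def fun_eq_iff intro!: sum.cong)
  have "(\<forall>k\<le>n + 1. \<forall>u v. rb_coeff ?Rs ?Rs ?Ss k u v = 0 \<and> rb_coeff ?Ss ?Rs ?Ss k u v = 0) \<longleftrightarrow>
    (\<forall>u v. rb_coeff ?Rs ?Rs ?Ss (n + 1) u v = 0 \<and> rb_coeff ?Ss ?Rs ?Ss (n + 1) u v = 0)"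
    using low by (metis le_Suc_eq Suc_eq_plus1 order_refl)
  also have "\<dots> \<longleftrightarrow> ?eqs"
    unfolding rb_coeff_Suc inner using d by simp
  finally show ?thesis
    unfolding order_deformation_iff using d lin by auto
qed

section \<open>The obstruction\<close>

lemma double_sum_antidiagonal:
  fixes f :: "nat \<Rightarrow> nat \<Rightarrow> 'g"
  shows "(\<Sum>i = 1..n. f i (n + 1 - i) + f (n + 1 - i) i) =
    (\<Sum>i = 1..n. f i (n + 1 - i)) + (\<Sum>i = 1..n. f i (n + 1 - i))"
proof -
  have "(\<Sum>i = 1..n. f (n + 1 - i) i) = (\<Sum>i = 1..n. f i (n + 1 - i))"
    by (rule sum.reindex_bij_witness[of _ "\<lambda>i. n + 1 - i" "\<lambda>i. n + 1 - i"]) auto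
  then show ?thesis by (simp add: sum.distrib)
qed

lemma sg_half_double:
  assumes "(2::'k) \<noteq> 0"
  shows "sg (1 / 2) (x + x) = x"
proof -
  have "sg (1 / 2) (x + x) = sg (1 / 2 + 1 / 2) x"
    by (simp only: scale_right_distrib scale_left_distrib)
  also have "1 / 2 + 1 / 2 = (1::'k)"
    using assms by (simp add: field_simps)
  finally show ?thesis by simp
qed

text \<open>
  Reflecting the sum along \<open>i + j = n + 1\<close> exchanges the two summands of each bracket, so the
  symmetrised sum is twice the inner part of the coefficient of \<open>t^(n + 1)\<close>.
\<close>

lemma obstruction_eq:
  assumes two: "(2::'k) \<noteq> 0"
    and lin: "\<And>i. Vector_Spaces.linear sv sg (Rs i)" "\<And>i. Vector_Spaces.linear sv sg (Ss i)"
  shows "obstruction n Rs Ss =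
    lift_pair (binary (rb_inner_coeff Rs Rs Ss n)) (binary (rb_inner_coeff Ss Rs Ss n))"
proof
  fix xs
  let ?b = "\<lambda>i j. cochain_bracket 1 1 (lift_pair (unary (Rs i)) (unary (Ss i)))
                     (lift_pair (unary (Rs j)) (unary (Ss j))) xs"
  have "(\<Sum>(i, j) \<in> {(i, j). i + j = n + 1 \<and> i \<ge> 1 \<and> j \<ge> 1}. ?b i j) = (\<Sum>i = 1..n. ?b i (n + 1 - i))"
    by (rule sum.reindex_bij_witness[of _ "\<lambda>i. (i, n + 1 - i)" fst]) (auto, metis diff_add_inverse)
  also have "\<dots> = lift_pair
      (binary (\<lambda>u v. - (rb_inner_coeff Rs Rs Ss n u v + rb_inner_coeff Rs Rs Ss n u v)))
      (binary (\<lambda>u v. - (rb_inner_coeff Ss Rs Ss n u v + rb_inner_coeff Ss Rs Ss n u v))) xs"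
  proof -
    have polar: "(\<Sum>i = 1..n. rb_defect (Ks i) (Ks (n + 1 - i)) (Rs (n + 1 - i)) (Ss (n + 1 - i)) u v
              + rb_defect (Ks (n + 1 - i)) (Ks i) (Rs i) (Ss i) u v)
        = rb_inner_coeff Ks Rs Ss n u v + rb_inner_coeff Ks Rs Ss n u v" for Ks u v
      unfolding rb_inner_coeff_def
      by (rule double_sum_antidiagonal[of "\<lambda>i j. rb_defect (Ks i) (Ks j) (Rs j) (Ss j) u v"])
    show ?thesis
      unfolding cochain_bracket_unary[OF lin lin] sum_lift_pair_binary sum_negf polar ..
  qed
  finally have sum: "(\<Sum>(i, j) \<in> {(i, j). i + j = n + 1 \<and> i \<ge> 1 \<and> j \<ge> 1}. ?b i j) = \<dots>" .
  have half: "- sg (1 / 2) (binary (\<lambda>u v. - (f u v + f u v)) vs) = binary f vs" for f vs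
    by (auto simp: binary_def sg_half_double[OF two] split: list.split simp del: minus_add_distrib)
  show "obstruction n Rs Ss xs =
      lift_pair (binary (rb_inner_coeff Rs Rs Ss n)) (binary (rb_inner_coeff Ss Rs Ss n)) xs"
    unfolding obstruction_def sum
    by (simp add: lift_pair_def Let_def scale_sum_def half del: minus_add_distrib)
qed

lemma obstruction_cochain:
  assumes "(2::'k) \<noteq> 0" "order_deformation n Rs Ss"
  shows "obstruction n Rs Ss \<in> cochains 2"
proof -
  from assms(2) have lin: "\<And>i. Vector_Spaces.linear sv sg (Rs i)"
    "\<And>i. Vector_Spaces.linear sv sg (Ss i)" by (auto simp: order_deformation_iff)
  have "bilinear_map sv sv sg (rb_inner_coeff Ks Rs Ss n)"
    if "\<And>i. Vector_Spaces.linear sv sg (Ks i)" for Ks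
    unfolding rb_inner_coeff_def by (intro bilinear_sum bilinear_rb_defect that lin)
  then have "multilinear sv sg 2 (binary (rb_inner_coeff Rs Rs Ss n))"
    "multilinear sv sg 2 (binary (rb_inner_coeff Ss Rs Ss n))"
    using lin by (simp_all add: multilinear_binary)
  then show ?thesis
    unfolding obstruction_eq[OF assms(1) lin] cochains_def by blast
qed

lemma order_deformation_extend_iff_differential:
  assumes two: "(2::'k) \<noteq> 0" and def: "order_deformation n Rs Ss"
    and lin: "Vector_Spaces.linear sv sg R'" "Vector_Spaces.linear sv sg S'"
  shows "order_deformation (n + 1) (Rs(n + 1 := R')) (Ss(n + 1 := S')) \<longleftrightarrow>
    obstruction n Rs Ss = differential 1 (lift_pair (unary R') (unary S'))"
proof -
  from def have lins: "\<And>i. Vector_Spaces.linear sv sg (Rs i)"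
    "\<And>i. Vector_Spaces.linear sv sg (Ss i)" by (auto simp: order_deformation_iff)
  show ?thesis
    unfolding order_deformation_extend_iff[OF def lin] obstruction_eq[OF two lins]
      differential_unary[OF lin] lift_pair_binary_eq_iff eq_neg_iff_add_eq_0 ..
qed

lemma extensible_iff_trivial_class:
  assumes two: "(2::'k) \<noteq> 0" and def: "order_deformation n Rs Ss"
  shows "extensible n Rs Ss \<longleftrightarrow> trivial_class 2 (obstruction_class n Rs Ss)"
proof -
  have "extensible n Rs Ss \<longleftrightarrow> (\<exists>c\<in>cochains 1. obstruction n Rs Ss = differential 1 c)"
    unfolding extensible_def Bex_def cochains_1_iff
    using order_deformation_extend_iff_differential[OF two def] by blast
  also have "\<dots> \<longleftrightarrow> trivial_class 2 (obstruction_class n Rs Ss)"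
    unfolding obstruction_class_def
    by (rule trivial_class_iff_coboundary[OF obstruction_cochain[OF two def], symmetric])
  finally show ?thesis .
qed

end

theorem theorem5p10:
  fixes sg :: "'k::field_char_0 \<Rightarrow> 'g::ab_group_add \<Rightarrow> 'g"
    and br :: "'g \<Rightarrow> 'g \<Rightarrow> 'g"
    and sv :: "'k \<Rightarrow> 'v::ab_group_add \<Rightarrow> 'v"
    and rL rR :: "'g \<Rightarrow> 'v \<Rightarrow> 'v"
    and R S :: "'v \<Rightarrow> 'g"
    and n :: nat
    and Rs Ss :: "nat \<Rightarrow> 'v \<Rightarrow> 'g"
  assumes "relative_rota_baxter_system sg br sv rL rR R S"
    and "relative_rota_baxter_system.order_deformation sg br sv rL rR R S n Rs Ss"
  shows "leibniz_representation.obstruction sg br sv rL rR n Rs Ss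
           \<in> leibniz_representation.cochains sg sv 2
       \<and> (relative_rota_baxter_system.extensible sg br sv rL rR R S n Rs Ss \<longleftrightarrow>
          relative_rota_baxter_system.trivial_class sg br sv rL rR R S 2
            (relative_rota_baxter_system.obstruction_class sg br sv rL rR R S n Rs Ss))"
proof -
  interpret relative_rota_baxter_system sg br sv rL rR R S by (rule assms(1))
  have two: "(2::'k) \<noteq> 0" by simp
  show ?thesis
    using obstruction_cochain[OF two assms(2)] extensible_iff_trivial_class[OF two assms(2)] ..
qed

end
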